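(* Let $a$ and $b\neq 0$ be complex numbers with $a^2\neq 4b$. Let $(w_m)_{m\in\mathbb{Z}}$ be a sequence of complex numbers with $w_{k+1}=aw_k-bw_{k-1}$ for all $k\in\mathbb{Z}$. For any complex number $c$ and integer $n\ge 2$, we have $$\det[w_{j-k}+c\,\delta_{jk}]_{1\le j,k\le n}=c^n+c^{n-1}nw_0+c^{n-2}\left(w_1^2-aw_0w_1+bw_0^2\right)\frac{u_n(a,b)^2\,b^{1-n}-n^2}{a^2-4b}.$$
   Context: $\delta_{jk}$ is the Kronecker delta ($1$ if $j=k$, $0$ otherwise). $\det[a_{jk}]_{1\le j,k\le n}$ is the determinant of the $n\times n$ matrix with $(j,k)$-entry $a_{jk}$. For complex numbers $a$ and $b\ne0$, the Lucas sequence $u_m=u_m(a,b)$ $(m\in\mathbb{Z})$ is defined by $u_0=0$, $u_1=1$ and $u_{k+1}=au_k-bu_{k-1}$ for all $k\in\mathbb{Z}$. The convention $c^0=1$ is used, also when $c=0$. *)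

theory Defs
  imports Complex_Main "Jordan_Normal_Form.Determinant"
begin

text \<open>
  The Lucas sequence is indexed by all integers. The recurrence determines \<open>u\<^sub>k\<close> for
  \<open>k \<ge> 0\<close> from \<open>u\<^sub>0 = 0\<close> and \<open>u\<^sub>1 = 1\<close>. Read backwards as
  \<open>u\<^sub>k\<^sub>-\<^sub>1 = (a u\<^sub>k - u\<^sub>k\<^sub>+\<^sub>1) / b\<close>, which needs \<open>b \<noteq> 0\<close>, it determines the terms of
  negative index; \<open>lucas_neg a b m\<close> is the term of index \<open>- m\<close>.
\<close>

fun lucas_pos :: "complex \<Rightarrow> complex \<Rightarrow> nat \<Rightarrow> complex" where
  "lucas_pos a b 0 = 0"
| "lucas_pos a b (Suc 0) = 1"
| "lucas_pos a b (Suc (Suc m)) = a * lucas_pos a b (Suc m) - b * lucas_pos a b m"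

fun lucas_neg :: "complex \<Rightarrow> complex \<Rightarrow> nat \<Rightarrow> complex" where
  "lucas_neg a b 0 = 0"
| "lucas_neg a b (Suc 0) = (a * 0 - 1) / b"
| "lucas_neg a b (Suc (Suc m)) = (a * lucas_neg a b (Suc m) - lucas_neg a b m) / b"

definition lucas_u :: "complex \<Rightarrow> complex \<Rightarrow> int \<Rightarrow> complex" where
  "lucas_u a b m = (if 0 \<le> m then lucas_pos a b (nat m) else lucas_neg a b (nat (- m)))"

lemma lucas_u_0 [simp]: "lucas_u a b 0 = 0"
  by (simp add: lucas_u_def)

lemma lucas_u_1 [simp]: "lucas_u a b 1 = 1"
  by (simp add: lucas_u_def)

lemma lucas_u_rec:
  assumes "b \<noteq> 0"
  shows "lucas_u a b (k + 1) = a * lucas_u a b k - b * lucas_u a b (k - 1)"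
proof -
  consider m where "k = int (Suc m)" | "k = 0" | "k = - 1" | m where "k = - int (Suc (Suc m))"
  proof (cases "k \<ge> 1")
    case True
    then have "k = int (Suc (nat (k - 1)))" by simp
    then show ?thesis by (rule that(1))
  next
    case False
    show ?thesis
    proof (cases "k \<ge> - 1")
      case True
      with False show ?thesis using that(2,3) by linarith
    next
      case False
      then have "k = - int (Suc (Suc (nat (- k - 2))))" by simp
      then show ?thesis by (rule that(4))
    qed
  qed
  then show ?thesis
  proof cases
    case (1 m)
    then have "nat (k + 1) = Suc (Suc m)" "nat k = Suc m" "nat (k - 1) = m" "k \<ge> 1" by auto
    then show ?thesis by (simp add: lucas_u_def)
  next
    case 2
    then show ?thesis using assms by (simp add: lucas_u_def)
  next
    case 3
    then show ?thesis using assms by (simp add: lucas_u_def numeral_2_eq_2)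
  next
    case (4 m)
    then have "nat (- (k + 1)) = Suc m" "nat (- k) = Suc (Suc m)"
      "nat (- (k - 1)) = Suc (Suc (Suc m))" "k + 1 < 0" by auto
    then show ?thesis using assms by (simp add: lucas_u_def)
  qed
qed

end

theory Submission
  imports Defs
begin

text \<open>
  Let \<open>\<alpha>\<close> and \<open>\<beta>\<close> be the roots of \<open>x\<^sup>2 - a x + b\<close>. They are nonzero because \<open>b \<noteq> 0\<close> and distinct
  because \<open>a\<^sup>2 \<noteq> 4 b\<close>, so a sequence satisfying the recurrence has the form
  \<open>w\<^sub>m = p \<alpha>\<^sup>m + q \<beta>\<^sup>m\<close> (\<open>recurrence_binet\<close>). Then \<open>w\<^sub>j\<^sub>-\<^sub>k = p \<alpha>\<^sup>j \<alpha>\<^sup>-\<^sup>k + q \<beta>\<^sup>j \<beta>\<^sup>-\<^sup>k\<close>: the matrix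
  \<open>(w\<^sub>j\<^sub>-\<^sub>k)\<close> factors through a space of dimension two, and Sylvester's determinant identity
  (\<open>det_sylvester\<close>) reduces the \<open>n \<times> n\<close> determinant to \<open>c\<^sup>n\<^sup>-\<^sup>2\<close> times the \<open>2 \<times> 2\<close> determinant
  \<open>(c + n p) (c + n q) - p q S S'\<close>, where \<open>S\<close> and \<open>S'\<close> are the geometric sums with ratios
  \<open>\<alpha> / \<beta>\<close> and \<open>\<beta> / \<alpha>\<close>.

  The three ingredients of the formula come from symmetric functions of \<open>\<alpha>\<close> and \<open>\<beta>\<close>: \<open>p + q = w\<^sub>0\<close>, the
  discriminant gives \<open>p q (a\<^sup>2 - 4 b) = - (w\<^sub>1\<^sup>2 - a w\<^sub>0 w\<^sub>1 + b w\<^sub>0\<^sup>2)\<close>, and since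
  \<open>u\<^sub>n = (\<alpha>\<^sup>n - \<beta>\<^sup>n) / (\<alpha> - \<beta>)\<close> the product \<open>S S'\<close> equals \<open>u\<^sub>n\<^sup>2 b\<^sup>1\<^sup>-\<^sup>n\<close>.
\<close>

section \<open>Sylvester's determinant identity and rank-two matrices\<close>

text \<open>
  The block \<open>- V\<close> of the matrix with rows \<open>(x I, U)\<close> and \<open>(- V, I)\<close> can be eliminated in two ways.
  Column operations with the lower right block turn the upper left block into \<open>x I + U V\<close>.
  Row operations with the upper left block \<open>x I\<close> require scaling the lower rows by \<open>x\<close>,
  which produces the power of \<open>x\<close> on the left, and turn the lower right block into \<open>x I + V U\<close>.
\<close>
lemma det_sylvester_scaled:
  fixes x :: "'a :: idom"
  assumes U: "U \<in> carrier_mat n m" and V: "V \<in> carrier_mat m n"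
  shows "x ^ m * det (x \<cdot>\<^sub>m 1\<^sub>m n + U * V) = x ^ n * det (x \<cdot>\<^sub>m 1\<^sub>m m + V * U)"
proof -
  let ?M = "four_block_mat (x \<cdot>\<^sub>m 1\<^sub>m n) U (- V) (1\<^sub>m m)"
  let ?R = "four_block_mat (1\<^sub>m n) (0\<^sub>m n m) V (1\<^sub>m m)"
  let ?L = "four_block_mat (1\<^sub>m n) (0\<^sub>m n m) V (x \<cdot>\<^sub>m 1\<^sub>m m)"
  have M: "?M \<in> carrier_mat (n + m) (n + m)"
    and R: "?R \<in> carrier_mat (n + m) (n + m)"
    and L: "?L \<in> carrier_mat (n + m) (n + m)"
    using U V by auto
  have "?M * ?R = four_block_mat (x \<cdot>\<^sub>m 1\<^sub>m n + U * V) U (0\<^sub>m m n) (1\<^sub>m m)"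
    by (subst mult_four_block_mat[of _ n n _ m _ m _ _ n _ m]; use U V in simp)
  then have MR: "det ?M * det ?R = det (x \<cdot>\<^sub>m 1\<^sub>m n + U * V)"
    using U V by (simp flip: det_mult[OF M R]
      add: det_four_block_mat_lower_left_zero[of _ n _ m])
  have "V * (x \<cdot>\<^sub>m 1\<^sub>m n) = x \<cdot>\<^sub>m V"
    using V by (simp add: mult_smult_distrib[OF V one_carrier_mat])
  moreover have "(x \<cdot>\<^sub>m 1\<^sub>m m) * (- V) = - (x \<cdot>\<^sub>m V)"
    using V by (simp add: mult_smult_assoc_mat[OF one_carrier_mat, of "- V" m n], auto)
  ultimately have "V * (x \<cdot>\<^sub>m 1\<^sub>m n) + (x \<cdot>\<^sub>m 1\<^sub>m m) * (- V) = 0\<^sub>m m n"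
    using V by auto
  moreover have "V * U + x \<cdot>\<^sub>m 1\<^sub>m m * 1\<^sub>m m = x \<cdot>\<^sub>m 1\<^sub>m m + V * U"
    using U V by (auto intro!: eq_matI)
  moreover have "x \<cdot>\<^sub>m 1\<^sub>m n + - 0\<^sub>m n n = x \<cdot>\<^sub>m 1\<^sub>m n"
    by auto
  ultimately have "?L * ?M = four_block_mat (x \<cdot>\<^sub>m 1\<^sub>m n) U (0\<^sub>m m n) (x \<cdot>\<^sub>m 1\<^sub>m m + V * U)"
    by (subst mult_four_block_mat[of _ n n _ m _ m _ _ n _ m]; use U V in simp)
  then have LM: "det ?L * det ?M = x ^ n * det (x \<cdot>\<^sub>m 1\<^sub>m m + V * U)"
    using U V by (simp flip: det_mult[OF L M]
      add: det_four_block_mat_lower_left_zero[of _ n _ m])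
  have "det ?R = 1" "det ?L = x ^ m"
    using V by (simp_all add: det_four_block_mat_upper_right_zero[of _ n _ m])
  with MR LM show ?thesis by simp
qed

text \<open>
  Cancelling \<open>x\<^sup>m\<close> from the scaled identity fails at \<open>x = 0\<close>, so the scaled identity is used
  in the polynomial ring, at the indeterminate, where cancellation is allowed; the
  result is then evaluated at \<open>x\<close>.
\<close>
lemma det_sylvester:
  fixes x :: "'a :: idom"
  assumes U: "U \<in> carrier_mat n m" and V: "V \<in> carrier_mat m n" and mn: "m \<le> n"
  shows "det (x \<cdot>\<^sub>m 1\<^sub>m n + U * V) = x ^ (n - m) * det (x \<cdot>\<^sub>m 1\<^sub>m m + V * U)"
proof -
  interpret ev: comm_ring_hom "\<lambda>p. poly p x"
    by unfold_locales auto
  let ?C = "map_mat (\<lambda>r :: 'a. [:r:])"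
  let ?X = "[:0, 1:] :: 'a poly"
  have CU: "?C U \<in> carrier_mat n m" and CV: "?C V \<in> carrier_mat m n"
    using U V by auto
  have ev_det: "poly (det (?X \<cdot>\<^sub>m 1\<^sub>m k + ?C A * ?C B)) x = det (x \<cdot>\<^sub>m 1\<^sub>m k + A * B)"
    if "A \<in> carrier_mat k l" "B \<in> carrier_mat l k" for A B :: "'a mat" and k l
  proof -
    have "map_mat (\<lambda>p. poly p x) (?X \<cdot>\<^sub>m 1\<^sub>m k + ?C A * ?C B) = x \<cdot>\<^sub>m 1\<^sub>m k + A * B"
      using that by (auto intro!: eq_matI simp: scalar_prod_def poly_sum mult.commute)
    then show ?thesis
      using ev.hom_det by metis
  qed
  have "?X ^ n = ?X ^ m * ?X ^ (n - m)"
    using mn by (simp flip: power_add)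
  with det_sylvester_scaled[OF CU CV, of ?X]
  have "?X ^ m * det (?X \<cdot>\<^sub>m 1\<^sub>m n + ?C U * ?C V)
      = ?X ^ m * (?X ^ (n - m) * det (?X \<cdot>\<^sub>m 1\<^sub>m m + ?C V * ?C U))"
    by (simp only: mult.assoc)
  then have "det (?X \<cdot>\<^sub>m 1\<^sub>m n + ?C U * ?C V)
      = ?X ^ (n - m) * det (?X \<cdot>\<^sub>m 1\<^sub>m m + ?C V * ?C U)"
    by simp
  from arg_cong[OF this, of "\<lambda>p. poly p x"] show ?thesis
    by (simp add: ev_det[OF U V] ev_det[OF V U])
qed

lemma det_dim_two:
  assumes "A \<in> carrier_mat 2 2"
  shows "det A = A $$ (0, 0) * A $$ (1, 1) - A $$ (0, 1) * A $$ (1, 0)"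
  using assms by (subst laplace_expansion_row[of _ 2 0])
    (auto simp: numeral_2_eq_2 cofactor_def det_single mat_delete_def)

lemma det_rank_two_plus_scalar:
  fixes x :: "'a :: idom" and f1 f2 g1 g2 :: "nat \<Rightarrow> 'a"
  assumes n: "n \<ge> 2"
  shows "det (mat n n (\<lambda>(j, k). f1 j * g1 k + f2 j * g2 k + x * (if j = k then 1 else 0))) =
    x ^ (n - 2) * ((x + (\<Sum>k<n. g1 k * f1 k)) * (x + (\<Sum>k<n. g2 k * f2 k))
      - (\<Sum>k<n. g1 k * f2 k) * (\<Sum>k<n. g2 k * f1 k))"
proof -
  let ?U = "mat n 2 (\<lambda>(j, i). if i = 0 then f1 j else f2 j)"
  let ?V = "mat 2 n (\<lambda>(i, k). if i = 0 then g1 k else g2 k)"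
  have "mat n n (\<lambda>(j, k). f1 j * g1 k + f2 j * g2 k + x * (if j = k then 1 else 0))
      = x \<cdot>\<^sub>m 1\<^sub>m n + ?U * ?V"
    by (auto intro!: eq_matI simp: scalar_prod_def numeral_2_eq_2)
  moreover have "det (x \<cdot>\<^sub>m 1\<^sub>m 2 + ?V * ?U) =
      (x + (\<Sum>k<n. g1 k * f1 k)) * (x + (\<Sum>k<n. g2 k * f2 k))
      - (\<Sum>k<n. g1 k * f2 k) * (\<Sum>k<n. g2 k * f1 k)"
    by (subst det_dim_two) (auto simp: scalar_prod_def lessThan_atLeast0)
  ultimately show ?thesis
    using det_sylvester[of ?U n 2 ?V x] n by simp
qed

section \<open>Two-sided second-order recurrences\<close>

lemma recurrence_unique:
  fixes v w :: "int \<Rightarrow> complex"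
  assumes b: "b \<noteq> 0"
    and v: "\<And>k. v (k + 1) = a * v k - b * v (k - 1)"
    and w: "\<And>k. w (k + 1) = a * w k - b * w (k - 1)"
    and init: "v 0 = w 0" "v 1 = w 1"
  shows "v k = w k"
proof -
  have "v k = w k \<and> v (k + 1) = w (k + 1)"
  proof (induction k rule: int_induct[where k = 0])
    case base
    show ?case using init by simp
  next
    case (step1 i)
    then show ?case using v[of "i + 1"] w[of "i + 1"] by simp
  next
    case (step2 i)
    have "b * v (i - 1) = a * v i - v (i + 1)" "b * w (i - 1) = a * w i - w (i + 1)"
      using v[of i] w[of i] by simp_all
    with step2 have "b * v (i - 1) = b * w (i - 1)" by simp
    with step2 b show ?case by simp
  qed
  then show ?thesis ..
qed

text \<open>
  The coefficients of the two geometric sequences solve \<open>p + q = w\<^sub>0\<close> and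
  \<open>p \<alpha> + q \<beta> = w\<^sub>1\<close>.
\<close>
lemma recurrence_binet:
  fixes w :: "int \<Rightarrow> complex" and \<alpha> \<beta> :: complex
  assumes nz: "\<alpha> \<noteq> 0" "\<beta> \<noteq> 0" and ne: "\<alpha> \<noteq> \<beta>"
    and w: "\<And>k. w (k + 1) = (\<alpha> + \<beta>) * w k - \<alpha> * \<beta> * w (k - 1)"
  shows "w k = (w 1 - \<beta> * w 0) / (\<alpha> - \<beta>) * \<alpha> powi k
             + (\<alpha> * w 0 - w 1) / (\<alpha> - \<beta>) * \<beta> powi k"
proof (rule recurrence_unique[where a = "\<alpha> + \<beta>" and b = "\<alpha> * \<beta>" and v = w, OF _ w])
  fix k
  define p where "p = (w 1 - \<beta> * w 0) / (\<alpha> - \<beta>)"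
  define q where "q = (\<alpha> * w 0 - w 1) / (\<alpha> - \<beta>)"
  have "p * \<alpha> powi (k + 1) + q * \<beta> powi (k + 1) =
      (\<alpha> + \<beta>) * (p * \<alpha> powi k + q * \<beta> powi k)
      - \<alpha> * \<beta> * (p * \<alpha> powi (k - 1) + q * \<beta> powi (k - 1))"
    using nz by (simp add: power_int_add power_int_diff field_simps)
  then show "(w 1 - \<beta> * w 0) / (\<alpha> - \<beta>) * \<alpha> powi (k + 1)
        + (\<alpha> * w 0 - w 1) / (\<alpha> - \<beta>) * \<beta> powi (k + 1) =
      (\<alpha> + \<beta>) * ((w 1 - \<beta> * w 0) / (\<alpha> - \<beta>) * \<alpha> powi k
        + (\<alpha> * w 0 - w 1) / (\<alpha> - \<beta>) * \<beta> powi k)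
      - \<alpha> * \<beta> * ((w 1 - \<beta> * w 0) / (\<alpha> - \<beta>) * \<alpha> powi (k - 1)
        + (\<alpha> * w 0 - w 1) / (\<alpha> - \<beta>) * \<beta> powi (k - 1))"
    by (simp only: p_def q_def)
next
  show "w 0 = (w 1 - \<beta> * w 0) / (\<alpha> - \<beta>) * \<alpha> powi 0
      + (\<alpha> * w 0 - w 1) / (\<alpha> - \<beta>) * \<beta> powi 0"
    using ne by (simp add: divide_simps) (simp add: algebra_simps)
  show "w 1 = (w 1 - \<beta> * w 0) / (\<alpha> - \<beta>) * \<alpha> powi 1
      + (\<alpha> * w 0 - w 1) / (\<alpha> - \<beta>) * \<beta> powi 1"
    using ne by (simp add: divide_simps) (simp add: algebra_simps)
qed (use nz in simp)

lemma lucas_u_binet: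
  assumes "\<alpha> \<noteq> 0" "\<beta> \<noteq> 0" "\<alpha> \<noteq> \<beta>"
  shows "lucas_u (\<alpha> + \<beta>) (\<alpha> * \<beta>) (int n) = (\<alpha> ^ n - \<beta> ^ n) / (\<alpha> - \<beta>)"
proof -
  have "lucas_u (\<alpha> + \<beta>) (\<alpha> * \<beta>) (k + 1) = (\<alpha> + \<beta>) * lucas_u (\<alpha> + \<beta>) (\<alpha> * \<beta>) k
      - \<alpha> * \<beta> * lucas_u (\<alpha> + \<beta>) (\<alpha> * \<beta>) (k - 1)" for k
    using assms by (intro lucas_u_rec) simp
  from recurrence_binet[OF assms this, of "int n"] show ?thesis
    by (simp add: diff_divide_distrib)
qed

text \<open>
  With ratio \<open>\<alpha> / \<beta>\<close> the geometric sum is \<open>u\<^sub>n / \<beta>\<^sup>n\<^sup>-\<^sup>1\<close>, and with ratio \<open>\<beta> / \<alpha>\<close> it is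
  \<open>u\<^sub>n / \<alpha>\<^sup>n\<^sup>-\<^sup>1\<close>.
\<close>
lemma geometric_sums_eq_lucas_u:
  fixes \<alpha> \<beta> :: complex
  assumes nz: "\<alpha> \<noteq> 0" "\<beta> \<noteq> 0" and ne: "\<alpha> \<noteq> \<beta>" and n: "n \<ge> 1"
  shows "(\<Sum>k<n. (\<alpha> / \<beta>) ^ k) * (\<Sum>k<n. (\<beta> / \<alpha>) ^ k)
    = (lucas_u (\<alpha> + \<beta>) (\<alpha> * \<beta>) (int n))\<^sup>2 * (\<alpha> * \<beta>) powi (1 - int n)"
proof -
  obtain m where m: "n = Suc m" using n by (cases n) auto
  have geo: "(\<Sum>k<n. (x / y) ^ k) = (x ^ n - y ^ n) / (x - y) / y ^ m"
    if "x \<noteq> y" "y \<noteq> 0" for x y :: complex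
  proof -
    have "x / y - 1 = (x - y) / y" "(x / y) ^ n - 1 = (x ^ n - y ^ n) / y ^ n"
      using that by (simp_all add: power_divide diff_divide_distrib)
    moreover have "x / y \<noteq> 1" using that by simp
    ultimately have "(\<Sum>k<n. (x / y) ^ k) = (x ^ n - y ^ n) / y ^ n / ((x - y) / y)"
      using geometric_sum[of "x / y" n] by metis
    also have "\<dots> = (x ^ n - y ^ n) / (x - y) / y ^ m"
      using that by (simp add: m)
    finally show ?thesis .
  qed
  have "(\<beta> ^ n - \<alpha> ^ n) / (\<beta> - \<alpha>) = (\<alpha> ^ n - \<beta> ^ n) / (\<alpha> - \<beta>)"
    by (metis minus_diff_eq minus_divide_divide)
  then have "(\<Sum>k<n. (\<alpha> / \<beta>) ^ k) * (\<Sum>k<n. (\<beta> / \<alpha>) ^ k)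
      = ((\<alpha> ^ n - \<beta> ^ n) / (\<alpha> - \<beta>))\<^sup>2 / (\<alpha> * \<beta>) ^ m"
    using nz ne by (simp add: geo power2_eq_square power_mult_distrib mult.commute)
  moreover have "(\<alpha> * \<beta>) powi (1 - int n) = inverse ((\<alpha> * \<beta>) ^ m)"
    by (simp add: m power_int_minus)
  ultimately show ?thesis
    unfolding lucas_u_binet[OF nz ne] by (simp only: divide_inverse)
qed

section \<open>The determinant formula\<close>

theorem theorem1p3:
  fixes a b c :: complex and w :: "int \<Rightarrow> complex" and n :: nat
  assumes "b \<noteq> 0"
    and "a\<^sup>2 \<noteq> 4 * b"
    and "\<forall>k. w (k + 1) = a * w k - b * w (k - 1)"
    and "n \<ge> 2"
  shows "det (mat n n (\<lambda>(j, k). w (int j - int k) + c * (if j = k then 1 else 0))) =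
    c ^ n + c ^ (n - 1) * of_nat n * w 0
    + c ^ (n - 2) * ((w 1)\<^sup>2 - a * w 0 * w 1 + b * (w 0)\<^sup>2)
      * (((lucas_u a b (int n))\<^sup>2 * b powi (1 - int n) - (of_nat n)\<^sup>2) / (a\<^sup>2 - 4 * b))"
proof -
  define d where "d = csqrt (a\<^sup>2 - 4 * b)"
  define \<alpha> where "\<alpha> = (a + d) / 2"
  define \<beta> where "\<beta> = (a - d) / 2"
  have d2: "d\<^sup>2 = a\<^sup>2 - 4 * b" by (simp add: d_def)
  have a: "a = \<alpha> + \<beta>" by (simp add: \<alpha>_def \<beta>_def field_simps)
  have b: "b = \<alpha> * \<beta>"
    using d2 by (simp add: \<alpha>_def \<beta>_def field_simps power2_eq_square)
  have d: "d = \<alpha> - \<beta>" by (simp add: \<alpha>_def \<beta>_def field_simps)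
  have nz: "\<alpha> \<noteq> 0" "\<beta> \<noteq> 0" using assms(1) b by auto
  have "d \<noteq> 0" using d2 assms(2) by auto
  then have ne: "\<alpha> \<noteq> \<beta>" using d by auto
  define p where "p = (w 1 - \<beta> * w 0) / (\<alpha> - \<beta>)"
  define q where "q = (\<alpha> * w 0 - w 1) / (\<alpha> - \<beta>)"
  have w: "w k = p * \<alpha> powi k + q * \<beta> powi k" for k
    unfolding p_def q_def using assms(3) by (intro recurrence_binet[OF nz ne]) (simp add: a b)
  define S where "S = (\<Sum>k<n. (\<alpha> / \<beta>) ^ k)"
  define S' where "S' = (\<Sum>k<n. (\<beta> / \<alpha>) ^ k)"
  have "w (int j - int k) = p * \<alpha> ^ j * inverse \<alpha> ^ k + q * \<beta> ^ j * inverse \<beta> ^ k" for j k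
    using nz by (simp add: w power_int_diff field_simps)
  then have "det (mat n n (\<lambda>(j, k). w (int j - int k) + c * (if j = k then 1 else 0))) =
      c ^ (n - 2) * ((c + (\<Sum>k<n. inverse \<alpha> ^ k * (p * \<alpha> ^ k)))
          * (c + (\<Sum>k<n. inverse \<beta> ^ k * (q * \<beta> ^ k)))
        - (\<Sum>k<n. inverse \<alpha> ^ k * (q * \<beta> ^ k)) * (\<Sum>k<n. inverse \<beta> ^ k * (p * \<alpha> ^ k)))"
    using det_rank_two_plus_scalar[OF assms(4)] by simp
  also have "(\<Sum>k<n. inverse \<alpha> ^ k * (p * \<alpha> ^ k)) = of_nat n * p"
    using nz by (simp add: field_simps)
  also have "(\<Sum>k<n. inverse \<beta> ^ k * (q * \<beta> ^ k)) = of_nat n * q"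
    using nz by (simp add: field_simps)
  also have "(\<Sum>k<n. inverse \<alpha> ^ k * (q * \<beta> ^ k)) = q * S'"
    by (simp add: S'_def sum_distrib_left field_simps)
  also have "(\<Sum>k<n. inverse \<beta> ^ k * (p * \<alpha> ^ k)) = p * S"
    by (simp add: S_def sum_distrib_left field_simps)
  also have "c ^ (n - 2) * ((c + of_nat n * p) * (c + of_nat n * q) - q * S' * (p * S)) =
      c ^ (n - 2) * c\<^sup>2 + c ^ (n - 2) * c * of_nat n * (p + q)
      + c ^ (n - 2) * (- (p * q)) * (S * S' - (of_nat n)\<^sup>2)"
    by (simp add: algebra_simps power2_eq_square)
  also have "c ^ (n - 2) * c\<^sup>2 = c ^ n"
    using assms(4) by (metis le_add_diff_inverse2 power_add)
  also have "c ^ (n - 2) * c = c ^ (n - 1)"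
    using assms(4) power_add[of c "n - 2" 1] by (simp add: numeral_2_eq_2 Suc_diff_Suc)
  also have "p + q = w 0"
    by (simp add: w)
  also have "- (p * q) = ((w 1)\<^sup>2 - a * w 0 * w 1 + b * (w 0)\<^sup>2) / (a\<^sup>2 - 4 * b)"
  proof -
    have "- ((w 1 - \<beta> * w 0) * (\<alpha> * w 0 - w 1)) = (w 1)\<^sup>2 - a * w 0 * w 1 + b * (w 0)\<^sup>2"
      by (simp add: a b algebra_simps power2_eq_square)
    moreover have "(\<alpha> - \<beta>) * (\<alpha> - \<beta>) = a\<^sup>2 - 4 * b"
      using d d2 by (simp add: power2_eq_square)
    ultimately show ?thesis
      unfolding p_def q_def by (metis minus_divide_left times_divide_times_eq)
  qed
  also have "S * S' = (lucas_u a b (int n))\<^sup>2 * b powi (1 - int n)"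
    unfolding S_def S'_def a b using geometric_sums_eq_lucas_u[OF nz ne] assms(4) by simp
  finally show ?thesis by simp
qed

end
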